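(* Let $(X,\|\cdot\|_n)$ and $(Y,|\cdot|_n)$ be Fréchet spaces and let $F:X\rightrightarrows Y$ be a multi-valued map with closed graph. Let $U\subset X$ and $V\subset Y$ be open and such that $\mathrm{Gr}\,F\cap(U\times V)\ne\emptyset$. Assume that for some $\mathbf{s}\in\mathbb{R}_+^\infty$ and some non-empty set $C\subset Y$ it holds that $$D'F(x,y)(\Pi_{\mathbf{s}}(X))\supset C,\quad\forall (x,y)\in(U\times V)\cap\mathrm{Gr}\,F.$$ Then $$\mathrm{cl}\,F(x+\Pi_{\mathbf{s}}(X))\supset y+C$$ for all $(x,y)\in\mathrm{Gr}\,F$ such that $x+\Pi_{\mathbf{s}}(X)\subset U$ and $[y,y+C]\subset V$.
   Context: A Fréchet space $(X,\|\cdot\|_n)$ is a linear space $X$ with a fixed collection of seminorms $\|\cdot\|_n$, $n=0,1,2,\ldots$, which is separating ($\|x\|_n=0$ for all $n$ iff $x=0$) and such that $X$ is complete in the metric $$\rho_X(x,y):=\max_{n\ge 0}\frac{2^{-n}\|x-y\|_n}{1+\|x-y\|_n}.$$ Topological notions in $X$ refer to $\rho_X$; similarly for $Y$ with $\rho_Y$ built from $|\cdot|_n$. $\mathbb{R}_+^\infty:=\{(s_i)_{i=0}^\infty:\ s_i\ge 0\}$. For $\mathbf{s}=(s_i)_{i=0}^\infty\in\mathbb{R}_+^\infty$, $\Pi_{\mathbf{s}}(X):=\{x\in X:\ \|x\|_n\le s_n,\ \forall n\ge 0\}$. For a multi-valued map $F$ (values are subsets of $Y$, possibly empty), $\mathrm{Gr}\,F:=\{(x,y):\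 y\in F(x)\}$ and $F(A):=\bigcup_{a\in A}F(a)$; $\mathrm{cl}$ denotes closure. For $(x,y)\in\mathrm{Gr}\,F$ and a non-empty set $A\subset X$, the set $D'F(x,y)(A)\subset Y$ is defined by $$v\in D'F(x,y)(A)\iff \exists\, t_n\downarrow 0:\ \lim_{n\to\infty}\frac{\inf\rho_Y(F(x+t_nA),\,y+t_nv)}{t_n}=0,$$ where $\inf\rho_Y(B,z):=\inf_{b\in B}\rho_Y(b,z)$ (with $\inf\emptyset=+\infty$). For $y\in Y$ and non-empty $C\subset Y$, $[y,y+C]:=\{y+tc:\ c\in C,\ t\in[0,1]\}$. *)

theory Defs
  imports "HOL-Analysis.Analysis"
begin

definition seminorm :: "('a::real_vector \<Rightarrow> real) \<Rightarrow> bool" where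
  "seminorm p \<longleftrightarrow>
     (\<forall>x. 0 \<le> p x) \<and> (\<forall>x y. p (x + y) \<le> p x + p y) \<and> (\<forall>c x. p (c *\<^sub>R x) = \<bar>c\<bar> * p x)"

text \<open>The supremum is in fact attained, see \<open>frechet_dist_attained\<close> below, so it is the maximum.\<close>

definition frechet_dist :: "(nat \<Rightarrow> 'a::real_vector \<Rightarrow> real) \<Rightarrow> 'a \<Rightarrow> 'a \<Rightarrow> real" where
  "frechet_dist p x y = (SUP n. ((1/2) ^ n * p n (x - y)) / (1 + p n (x - y)))"

locale seminorm_family =
  fixes p :: "nat \<Rightarrow> 'a::real_vector \<Rightarrow> real"
  assumes seminorm: "\<And>n. seminorm (p n)"
    and separating: "\<And>x. (\<forall>n. p n x = 0) \<longleftrightarrow> x = (0::'a)"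
begin

lemma seminorm_nonneg: "0 \<le> p n x"
  using seminorm[of n] by (simp add: seminorm_def)

lemma triangle_p: "p n (x + y) \<le> p n x + p n y"
  using seminorm[of n] by (simp add: seminorm_def)

lemma minus_commute_p: "p n (x - y) = p n (y - x)"
proof -
  have "p n ((-1) *\<^sub>R (y - x)) = \<bar>-1\<bar> * p n (y - x)"
    using seminorm[of n] unfolding seminorm_def by blast
  then show ?thesis by simp
qed

abbreviation dterm :: "'a \<Rightarrow> nat \<Rightarrow> real" where
  "dterm z n \<equiv> ((1/2) ^ n * p n z) / (1 + p n z)"

lemma dterm_nonneg: "0 \<le> dterm z n"
  using seminorm_nonneg[of n z] by simp

lemma dterm_le: "dterm z n \<le> (1/2) ^ n"
proof -
  have "(1/2::real) ^ n * p n z \<le> (1/2) ^ n * (1 + p n z)"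
    by (intro mult_left_mono) auto
  moreover have "0 < 1 + p n z" using seminorm_nonneg[of n z] by linarith
  ultimately show ?thesis by (simp add: pos_divide_le_eq)
qed

lemma bdd_dterm: "bdd_above (range (dterm z))"
proof (rule bdd_aboveI2)
  show "dterm z n \<le> 1" for n
    by (rule order_trans[OF dterm_le]) (simp add: power_le_one)
qed

lemma dterm_le_dist: "dterm (x - y) n \<le> frechet_dist p x y"
  unfolding frechet_dist_def by (rule cSUP_upper[OF _ bdd_dterm]) simp

lemma frechet_dist_attained:
  "\<exists>n. frechet_dist p x y = ((1/2) ^ n * p n (x - y)) / (1 + p n (x - y))"
proof -
  let ?f = "dterm (x - y)"
  have "\<exists>m. \<forall>n. ?f n \<le> ?f m"
  proof (cases "\<forall>n. ?f n = 0")
    case True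
    then have "\<forall>n. ?f n \<le> ?f 0" by (metis order_refl)
    then show ?thesis by blast
  next
    case False
    then obtain k where "?f k \<noteq> 0" by blast
    with dterm_nonneg[where z = "x - y" and n = k] have k: "0 < ?f k" by linarith
    obtain N where N: "(1/2::real) ^ N < ?f k"
      using real_arch_pow_inv[OF k, of "1/2"] by auto
    have "Max (?f ` {..max N k}) \<in> ?f ` {..max N k}" by (rule Max_in) auto
    then obtain m where m: "Max (?f ` {..max N k}) = ?f m" by blast
    have le: "?f n \<le> ?f m" if "n \<le> max N k" for n
      using that unfolding m[symmetric] by (intro Max_ge) auto
    have "?f n \<le> ?f m" for n
    proof (cases "n \<le> max N k")
      case True
      then show ?thesis by (rule le)
    next
      case False
      have "?f n \<le> (1/2) ^ n" by (rule dterm_le)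
      also have "\<dots> \<le> (1/2) ^ N" using False by (intro power_decreasing) auto
      also have "\<dots> \<le> ?f k" using N by simp
      also have "\<dots> \<le> ?f m" by (rule le) simp
      finally show ?thesis .
    qed
    then show ?thesis by blast
  qed
  then obtain m where m: "\<And>n. ?f n \<le> ?f m" by blast
  have "frechet_dist p x y = ?f m"
  proof (rule antisym)
    show "frechet_dist p x y \<le> ?f m"
      unfolding frechet_dist_def by (rule cSUP_least) (auto intro: m)
  qed (rule dterm_le_dist)
  then show ?thesis by blast
qed

lemma dterm_triangle: "dterm (x + y) n \<le> dterm x n + dterm y n"
proof -
  let ?a = "p n x" and ?b = "p n y" and ?c = "p n (x + y)"
  have nn: "0 \<le> ?a" "0 \<le> ?b" "0 \<le> ?c" and le: "?c \<le> ?a + ?b"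
    by (rule seminorm_nonneg triangle_p)+
  have "?c / (1 + ?c) \<le> (?a + ?b) / (1 + (?a + ?b))"
    using nn le by (simp add: frac_le_eq divide_simps algebra_simps)
  also have "\<dots> = ?a / (1 + (?a + ?b)) + ?b / (1 + (?a + ?b))"
    by (rule add_divide_distrib)
  also have "\<dots> \<le> ?a / (1 + ?a) + ?b / (1 + ?b)"
    using nn by (intro add_mono divide_left_mono) auto
  finally have "(1/2) ^ n * (?c / (1 + ?c)) \<le> (1/2) ^ n * (?a / (1 + ?a) + ?b / (1 + ?b))"
    by (intro mult_left_mono) auto
  then show ?thesis by (simp add: distrib_left)
qed

sublocale Metric_space UNIV "frechet_dist p"
proof
  show "0 \<le> frechet_dist p x y" for x y
    using dterm_le_dist[where x = x and y = y and n = 0] dterm_nonneg[where z = "x - y" and n = 0] by linarith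
  show "frechet_dist p x y = frechet_dist p y x" for x y
    by (simp add: frechet_dist_def minus_commute_p[of _ x y])
  show "(frechet_dist p x y = 0) = (x = y)" for x y
  proof
    assume 0: "frechet_dist p x y = 0"
    have "p n (x - y) = 0" for n
    proof -
      have "dterm (x - y) n = 0"
        using dterm_le_dist[where x = x and y = y and n = n] dterm_nonneg[where z = "x - y" and n = n] 0 by linarith
      moreover have "1 + p n (x - y) \<noteq> 0" using seminorm_nonneg[of n "x - y"] by linarith
      ultimately show ?thesis by simp
    qed
    then show "x = y" using separating[of "x - y"] by simp
  next
    assume "x = y"
    then have "p n (x - y) = 0" for n using separating[of "x - y"] by simp
    then show "frechet_dist p x y = 0" by (simp add: frechet_dist_def)
  qed
  show "frechet_dist p x z \<le> frechet_dist p x y + frechet_dist p y z" for x y z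
  proof -
    obtain n where n: "frechet_dist p x z = dterm (x - z) n"
      using frechet_dist_attained by blast
    also have "\<dots> \<le> dterm (x - y) n + dterm (y - z) n"
      using dterm_triangle[where x = "x - y" and y = "y - z" and n = n] by simp
    also have "\<dots> \<le> frechet_dist p x y + frechet_dist p y z"
      by (intro add_mono dterm_le_dist)
    finally show ?thesis .
  qed
qed

end

locale frechet_space = seminorm_family +
  assumes complete: "mcomplete"

abbreviation frechet_topology :: "(nat \<Rightarrow> 'a::real_vector \<Rightarrow> real) \<Rightarrow> 'a topology" where
  "frechet_topology p \<equiv> Metric_space.mtopology UNIV (frechet_dist p)"

definition Pi_box :: "(nat \<Rightarrow> 'a::real_vector \<Rightarrow> real) \<Rightarrow> (nat \<Rightarrow> real) \<Rightarrow> 'a set" where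
  "Pi_box p s = {x. \<forall>n. p n x \<le> s n}"

definition Gr :: "('a \<Rightarrow> 'b set) \<Rightarrow> ('a \<times> 'b) set" where
  "Gr F = {(x, y). y \<in> F x}"

definition mv_image :: "('a \<Rightarrow> 'b set) \<Rightarrow> 'a set \<Rightarrow> 'b set" where
  "mv_image F A = (\<Union>a\<in>A. F a)"

text \<open>Extended-real valued, so that the infimum over the empty set is \<open>\<infinity>\<close>.\<close>

definition inf_dist :: "('b \<Rightarrow> 'b \<Rightarrow> real) \<Rightarrow> 'b set \<Rightarrow> 'b \<Rightarrow> ereal" where
  "inf_dist d B z = (INF b\<in>B. ereal (d b z))"

text \<open>The seminorms \<open>q\<close> are those of the target space; those of the domain play no role here.\<close>

definition Dprime :: "(nat \<Rightarrow> 'b::real_vector \<Rightarrow> real) \<Rightarrow> ('a::real_vector \<Rightarrow> 'b set)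
    \<Rightarrow> 'a \<Rightarrow> 'b \<Rightarrow> 'a set \<Rightarrow> 'b set" where
  "Dprime q F x y A = {v. \<exists>t :: nat \<Rightarrow> real. (\<forall>n. 0 < t n) \<and> decseq t \<and> t \<longlonglongrightarrow> 0 \<and>
     (\<lambda>n. inf_dist (frechet_dist q) (mv_image F ((\<lambda>a. x + t n *\<^sub>R a) ` A)) (y + t n *\<^sub>R v)
            / ereal (t n)) \<longlonglongrightarrow> 0}"

definition segments :: "'b::real_vector \<Rightarrow> 'b set \<Rightarrow> 'b set" where
  "segments y C = {y + t *\<^sub>R c | t c. c \<in> C \<and> t \<in> {0..1}}"

end

theory Submission
  imports Defs
begin

text \<open>
  Fix \<open>(x, y)\<close> in the graph, \<open>c \<in> C\<close> and \<open>\<epsilon> > 0\<close> so small that the \<open>\<epsilon>\<close>-neighbourhood of the compact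
  segment \<open>[y, y + c]\<close> lies in \<open>V\<close>. Order the triples \<open>(a, b, t)\<close> with \<open>(a, b) \<in> Gr F\<close> and \<open>t \<le> 1\<close> by
  \<open>(a, b, t) \<le> (a', b', t')\<close> iff \<open>t \<le> t'\<close>, \<open>a' - a \<in> (t' - t) \<Pi>\<^sub>s(X)\<close> and
  \<open>\<rho>\<^sub>Y(b', b + (t' - t) c) \<le> \<epsilon> (t' - t)\<close>. Completeness and the closed graph bound increasing
  sequences, so by the Brezis-Browder ordering principle some element above \<open>(x, y, 0)\<close> cannot
  increase its parameter \<open>t\<close>. The derivative condition lets one increase \<open>t\<close> whenever \<open>t < 1\<close>;
  hence \<open>t = 1\<close> there, which gives a point of \<open>F(x + \<Pi>\<^sub>s(X))\<close> within \<open>\<epsilon>\<close> of \<open>y + c\<close>.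
\<close>

section \<open>The ordering principle\<close>

lemma brezis_browder:
  fixes R :: "'z \<Rightarrow> 'z \<Rightarrow> bool" and \<phi> :: "'z \<Rightarrow> real"
  assumes a: "a \<in> A"
    and trans: "\<And>x y z. R x y \<Longrightarrow> R y z \<Longrightarrow> R x z"
    and refl: "\<And>x. x \<in> A \<Longrightarrow> R x x"
    and mono: "\<And>x y. R x y \<Longrightarrow> \<phi> x \<le> \<phi> y"
    and bdd: "\<And>x. x \<in> A \<Longrightarrow> \<phi> x \<le> M"
    and chain: "\<And>f :: nat \<Rightarrow> 'z. range f \<subseteq> A \<Longrightarrow> (\<And>n. R (f n) (f (Suc n))) \<Longrightarrow> \<exists>u\<in>A. \<forall>n. R (f n) u"
  obtains m where "m \<in> A" "R a m" "\<And>z. z \<in> A \<Longrightarrow> R m z \<Longrightarrow> \<phi> z \<le> \<phi> m"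
proof -
  \<comment> \<open>Greedy choice: the supremum of \<open>\<phi>\<close> above \<open>x\<close> need
    not be attained, so \<open>y\<close> comes within \<open>(1/2) ^ n\<close> of it.\<close>
  have step: "\<exists>y. y \<in> A \<and> (R x y \<and> (\<forall>z\<in>A. R x z \<longrightarrow> \<phi> z \<le> \<phi> y + (1/2) ^ n))"
    if x: "x \<in> A" for x and n :: nat
  proof -
    let ?S = "{z \<in> A. R x z}"
    have ne: "?S \<noteq> {}" using x refl by blast
    have bd: "bdd_above (\<phi> ` ?S)" using bdd by (auto intro!: bdd_aboveI2)
    have "(SUP z\<in>?S. \<phi> z) - (1/2) ^ n < (SUP z\<in>?S. \<phi> z)" by simp
    then obtain y where y: "y \<in> ?S" "(SUP z\<in>?S. \<phi> z) - (1/2) ^ n < \<phi> y"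
      using less_cSUP_iff[OF ne bd] by blast
    have "\<phi> z \<le> \<phi> y + (1/2) ^ n" if "z \<in> A" "R x z" for z
      using cSUP_upper[OF _ bd, of z] that y(2) by simp
    with y(1) show ?thesis by blast
  qed
  let ?P = "\<lambda>n z. z \<in> A \<and> (n = (0::nat) \<longrightarrow> z = a)"
  let ?Q = "\<lambda>n x y. R x y \<and> (\<forall>z\<in>A. R x z \<longrightarrow> \<phi> z \<le> \<phi> y + (1/2) ^ n)"
  have "\<exists>f. \<forall>n. ?P n (f n) \<and> ?Q n (f n) (f (Suc n))"
  proof (rule dependent_nat_choice)
    show "\<exists>x. ?P 0 x" using a by simp
    show "\<exists>y. ?P (Suc n) y \<and> ?Q n x y" if "?P n x" for x n
      using step[of x n] that by simp
  qed
  then obtain f where f': "\<forall>n. ?P n (f n) \<and> ?Q n (f n) (f (Suc n))" by (rule exE)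
  have f: "\<And>n. f n \<in> A" "f 0 = a" "\<And>n. R (f n) (f (Suc n))"
    "\<And>n z. z \<in> A \<Longrightarrow> R (f n) z \<Longrightarrow> \<phi> z \<le> \<phi> (f (Suc n)) + (1/2) ^ n"
    using f' by simp_all
  obtain u where u: "u \<in> A" "\<And>n. R (f n) u" using chain[of f] f(1,3) by auto
  show thesis
  proof
    show "u \<in> A" by fact
    show "R a u" using u(2)[of 0] f(2) by simp
    fix z assume z: "z \<in> A" "R u z"
    \<comment> \<open>Whatever lies above \<open>u\<close> lies above every \<open>f n\<close>, so
      it competed in each greedy choice.\<close>
    have "\<phi> z \<le> \<phi> u + (1/2) ^ n" for n
      using f(4)[OF z(1) trans[OF u(2) z(2)], of n] mono[OF u(2)[of "Suc n"]] by linarith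
    moreover have "(\<lambda>n. \<phi> u + (1/2) ^ n) \<longlonglongrightarrow> \<phi> u + 0"
      by (intro tendsto_intros LIMSEQ_realpow_zero) auto
    ultimately show "\<phi> z \<le> \<phi> u" by (intro LIMSEQ_le_const[where X = "\<lambda>n. \<phi> u + (1/2) ^ n"]) auto
  qed
qed

section \<open>The metric and its seminorms\<close>

context seminorm_family
begin

lemma seminorm_scale: "p n (c *\<^sub>R x) = \<bar>c\<bar> * p n x"
  using seminorm[of n] by (simp add: seminorm_def)

lemma frechet_dist_diff: "frechet_dist p x y = frechet_dist p (x - y) 0"
  by (simp add: frechet_dist_def)

text \<open>Each term of the metric determines its seminorm continuously near 0; conversely, terms
  with large index are uniformly small, so only finitely many seminorms need control.\<close>

lemma frechet_dist_tendsto_0_iff: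
  "((\<lambda>i. frechet_dist p (f i) l) \<longlongrightarrow> 0) G \<longleftrightarrow> (\<forall>n. ((\<lambda>i. p n (f i - l)) \<longlongrightarrow> 0) G)"
proof (intro iffI allI)
  fix n assume lim: "((\<lambda>i. frechet_dist p (f i) l) \<longlongrightarrow> 0) G"
  have *: "((\<lambda>i. dterm (f i - l) n) \<longlongrightarrow> 0) G"
    by (rule tendsto_sandwich[OF _ _ tendsto_const lim])
      (auto intro!: always_eventually dterm_nonneg dterm_le_dist)
  \<comment> \<open>Without its weight the term is r / (1 + r) with r the seminorm; this is inverted
    by w / (1 - w).\<close>
  define w where "w i = 2 ^ n * dterm (f i - l) n" for i
  have w: "(w \<longlongrightarrow> 2 ^ n * 0) G" unfolding w_def by (intro tendsto_intros *)
  have "w i = p n (f i - l) / (1 + p n (f i - l))" for i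
    by (simp add: w_def power_one_over)
  then have eq: "p n (f i - l) = w i / (1 - w i)" for i
    using seminorm_nonneg[of n "f i - l"] by (simp add: field_simps)
  have "((\<lambda>i. w i / (1 - w i)) \<longlongrightarrow> 0 / (1 - 0)) G" using w by (intro tendsto_intros) auto
  then show "((\<lambda>i. p n (f i - l)) \<longlongrightarrow> 0) G" by (simp add: eq)
next
  assume lim: "\<forall>n. ((\<lambda>i. p n (f i - l)) \<longlongrightarrow> 0) G"
  show "((\<lambda>i. frechet_dist p (f i) l) \<longlongrightarrow> 0) G"
  proof (rule tendstoI)
    fix e :: real assume e: "0 < e"
    obtain N where N: "(1/2::real) ^ N < e" using real_arch_pow_inv[OF e, of "1/2"] by auto
    have "\<forall>\<^sub>F i in G. \<forall>n\<in>{..<N}. p n (f i - l) < e"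
      using lim e by (intro eventually_ball_finite) (auto dest: order_tendstoD(2))
    then show "\<forall>\<^sub>F i in G. dist (frechet_dist p (f i) l) 0 < e"
    proof eventually_elim
      case (elim i)
      obtain n where n: "frechet_dist p (f i) l = dterm (f i - l) n"
        using frechet_dist_attained by blast
      have "dterm (f i - l) n < e"
      proof (cases "n < N")
        case True
        have nn: "0 \<le> p n (f i - l)" by (rule seminorm_nonneg)
        have "dterm (f i - l) n \<le> p n (f i - l) / 1"
          using nn by (intro frac_le) (auto intro!: mult_left_le_one_le simp: power_le_one)
        also have "\<dots> < e" using elim True by simp
        finally show ?thesis .
      next
        case False
        have "dterm (f i - l) n \<le> (1/2) ^ n" by (rule dterm_le)
        also have "\<dots> \<le> (1/2) ^ N" using False by (intro power_decreasing) auto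
        finally show ?thesis using N by linarith
      qed
      then have "frechet_dist p (f i) l < e" by (simp only: n)
      then show ?case using nonneg[of "f i" l] by simp
    qed
  qed
qed

text \<open>The metric is not homogeneous, so small multiples of \<open>c\<close> are handled
  through the seminorms, which are.\<close>

lemma frechet_dist_scale_tendsto_0:
  assumes "(f \<longlongrightarrow> 0) G"
  shows "((\<lambda>i. frechet_dist p (f i *\<^sub>R c) 0) \<longlongrightarrow> 0) G"
proof -
  have "((\<lambda>i. \<bar>f i\<bar> * p n c) \<longlongrightarrow> \<bar>0\<bar> * p n c) G" for n by (intro tendsto_intros assms)
  then show ?thesis by (simp add: frechet_dist_tendsto_0_iff seminorm_scale)
qed

lemma frechet_dist_le_add: "frechet_dist p (x + y) 0 \<le> frechet_dist p x 0 + frechet_dist p y 0"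
  using triangle[of "x + y" y 0] frechet_dist_diff[of "x + y" y] by simp

text \<open>Going through a late \<open>f j\<close> gives the bound up to the vanishing error
  \<open>p n (f j - l)\<close>. This carries seminorm bounds of an increasing sequence over to its
  limit.\<close>

lemma limit_seminorm_le:
  assumes "\<And>n. ((\<lambda>i. p n (f i - l)) \<longlongrightarrow> 0) sequentially"
    and "\<And>i j. i \<le> j \<Longrightarrow> p n (f j - f i) \<le> b i"
  shows "p n (l - f i) \<le> b i"
proof (rule LIMSEQ_le_const[where X = "\<lambda>j. p n (f j - l) + b i"])
  have "(\<lambda>j. p n (f j - l) + b i) \<longlonglongrightarrow> 0 + b i" by (intro tendsto_intros assms)
  then show "(\<lambda>j. p n (f j - l) + b i) \<longlonglongrightarrow> b i" by simp
  have "p n (l - f i) \<le> p n (f j - l) + b i" if "j \<ge> i" for j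
    using triangle_p[of n "l - f j" "f j - f i"] assms(2)[OF that] minus_commute_p[of n l "f j"]
    by simp
  then show "\<exists>N. \<forall>j\<ge>N. p n (l - f i) \<le> p n (f j - l) + b i" by blast
qed

text \<open>Compactness of [0,1]: if no radius worked, points outside \<open>V\<close> would
  approach the segment, and along a subsequence of parameters they would converge to a point of it,
  where \<open>V\<close> is open.\<close>

lemma segment_nbhd:
  assumes V: "openin mtopology V" and seg: "\<And>t. t \<in> {0..1} \<Longrightarrow> y + t *\<^sub>R c \<in> V"
  obtains e where "e > 0" "\<And>t z. t \<in> {0..1} \<Longrightarrow> frechet_dist p z (y + t *\<^sub>R c) \<le> e \<Longrightarrow> z \<in> V"
proof (rule ccontr)
  assume neg: "\<not> thesis"
  have "\<exists>t z. t \<in> {0..1} \<and> frechet_dist p z (y + t *\<^sub>R c) \<le> inverse (Suc k) \<and> z \<notin> V" for k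
    using neg that[of "inverse (Suc k)"] by auto
  then obtain t z where tz: "\<And>k. t k \<in> {0..1::real}" "\<And>k. z k \<notin> V"
    "\<And>k. frechet_dist p (z k) (y + t k *\<^sub>R c) \<le> inverse (Suc k)" by metis
  obtain l r where l: "l \<in> {0..1}" "strict_mono r" "(t \<circ> r) \<longlonglongrightarrow> l"
    using compact_Icc[of 0 "1::real"] tz(1) unfolding compact_def by metis
  obtain \<delta> where \<delta>: "\<delta> > 0" "mball (y + l *\<^sub>R c) \<delta> \<subseteq> V"
    using V seg[OF l(1)] unfolding openin_mtopology by blast
  have "(\<lambda>k. t (r k) - l) \<longlonglongrightarrow> 0" using l(3) by (simp add: LIM_zero comp_def)
  \<comment> \<open>First summand: distance from \<open>z (r k)\<close> to its segment point.
    Second: by translation invariance, distance from that point to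
    \<open>y + l *\<^sub>R c\<close>.\<close>
  then have "(\<lambda>k. inverse (Suc (r k)) + frechet_dist p ((t (r k) - l) *\<^sub>R c) 0) \<longlonglongrightarrow> 0 + 0"
    using LIMSEQ_subseq_LIMSEQ[OF LIMSEQ_inverse_real_of_nat l(2)]
    by (intro tendsto_add frechet_dist_scale_tendsto_0) (auto simp: comp_def)
  then have "\<forall>\<^sub>F k in sequentially. inverse (Suc (r k)) + frechet_dist p ((t (r k) - l) *\<^sub>R c) 0 < \<delta>"
    using \<delta>(1) by (intro order_tendstoD(2)) auto
  then obtain k where k: "inverse (Suc (r k)) + frechet_dist p ((t (r k) - l) *\<^sub>R c) 0 < \<delta>"
    using eventually_happens by force
  have "frechet_dist p (z (r k)) (y + l *\<^sub>R c)
      \<le> frechet_dist p (z (r k)) (y + t (r k) *\<^sub>R c) + frechet_dist p (y + t (r k) *\<^sub>R c) (y + l *\<^sub>R c)"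
    by (rule triangle) auto
  also have "\<dots> < \<delta>"
    using k tz(3)[of "r k"] frechet_dist_diff[of "y + t (r k) *\<^sub>R c" "y + l *\<^sub>R c"]
    by (simp add: algebra_simps)
  finally have "z (r k) \<in> V" using \<delta>(2) by (auto simp: commute)
  with tz(2) show False by blast
qed

end

section \<open>Completeness and the maximality argument\<close>

lemma (in frechet_space) limit_exists_if_Cauchy:
  assumes "((\<lambda>ij. frechet_dist p (f (fst ij)) (f (snd ij))) \<longlongrightarrow> 0) (sequentially \<times>\<^sub>F sequentially)"
  obtains x where "limitin mtopology f x sequentially"
proof -
  have "\<exists>N. \<forall>m\<ge>N. \<forall>n\<ge>N. frechet_dist p (f m) (f n) < e" if "e > 0" for e
    using order_tendstoD(2)[OF assms that] unfolding eventually_prod_sequentially by fastforce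
  then have "MCauchy f" unfolding MCauchy_def by blast
  then show thesis using complete that unfolding mcomplete_def by blast
qed

text \<open>Once the quotient is below \<open>e\<close>, the infimum is strictly below
  \<open>e * t n\<close>; hence it is finite and some point of the image beats this bound.\<close>

lemma Dprime_step:
  assumes c: "c \<in> Dprime q F x y A" and e: "0 < e" and \<delta>: "0 < (\<delta>::real)"
  obtains h a b where "0 < h" "h < \<delta>" "a \<in> A" "b \<in> F (x + h *\<^sub>R a)"
    "frechet_dist q b (y + h *\<^sub>R c) < e * h"
proof -
  let ?I = "\<lambda>h. inf_dist (frechet_dist q) (mv_image F ((\<lambda>a. x + h *\<^sub>R a) ` A)) (y + h *\<^sub>R c)"
  obtain t :: "nat \<Rightarrow> real" where t: "\<And>n. 0 < t n" "t \<longlonglongrightarrow> 0" "(\<lambda>n. ?I (t n) / ereal (t n)) \<longlonglongrightarrow> 0"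
    using c unfolding Dprime_def by blast
  have "\<forall>\<^sub>F n in sequentially. t n < \<delta> \<and> ?I (t n) / ereal (t n) < ereal e"
    using t(2,3) e \<delta> by (intro eventually_conj order_tendstoD(2)) auto
  then obtain n where n: "t n < \<delta>" "?I (t n) / ereal (t n) < ereal e"
    using eventually_happens by force
  have "?I (t n) < ereal (e * t n)"
    using n(2) t(1)[of n] by (simp add: ereal_divide_less_iff mult.commute)
  then obtain b where "b \<in> mv_image F ((\<lambda>a. x + t n *\<^sub>R a) ` A)"
    "frechet_dist q b (y + t n *\<^sub>R c) < e * t n"
    unfolding inf_dist_def INF_less_iff by auto
  then show thesis using that[of "t n"] t(1) n(1) unfolding mv_image_def by blast
qed

text \<open>Assumption \<open>D\<close> asks for the derivative condition only at points that the
  ordering can reach from \<open>(x, y, 0)\<close>, so \<open>U\<close> and \<open>V\<close> do not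
  appear here.\<close>

lemma approximate_endpoint:
  assumes p: "frechet_space p" and q: "frechet_space q"
    and closed: "closedin (prod_topology (frechet_topology p) (frechet_topology q)) (Gr F)"
    and s0: "\<And>n. 0 \<le> s n" and xy: "y \<in> F x" and e: "0 < e"
    and D: "\<And>a b t. b \<in> F a \<Longrightarrow> t \<in> {0..1} \<Longrightarrow> (\<And>n. p n (a - x) \<le> t * s n)
      \<Longrightarrow> frechet_dist q b (y + t *\<^sub>R c) \<le> e * t \<Longrightarrow> c \<in> Dprime q F a b (Pi_box p s)"
  shows "\<exists>a b. b \<in> F a \<and> a - x \<in> Pi_box p s \<and> frechet_dist q b (y + c) \<le> e"
proof -
  interpret X: frechet_space p by fact
  interpret Y: frechet_space q by fact
  \<comment> \<open>All bounds are linear in \<open>t' - t\<close>, so they add up under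
    composition; this makes \<open>R\<close> transitive.\<close>
  define R where "R = (\<lambda>(a, b, t) (a', b', t'). t \<le> t' \<and> (\<forall>n. p n (a' - a) \<le> (t' - t) * s n) \<and>
    frechet_dist q (b' - b - (t' - t) *\<^sub>R c) 0 \<le> e * (t' - t))"
  define A where "A = {(a, b, t). b \<in> F a \<and> t \<le> (1::real)}"
  have trans: "R u w" if "R u v" "R v w" for u v w
  proof -
    obtain a b t a' b' t' a'' b'' t'' where uvw: "u = (a, b, t)" "v = (a', b', t')" "w = (a'', b'', t'')"
      by (metis prod_cases3)
    have 1: "p n (a'' - a) \<le> (t'' - t) * s n" for n
      using that X.triangle_p[of n "a'' - a'" "a' - a"] unfolding R_def uvw
      by (auto simp: algebra_simps) (smt (verit))
    have eq: "(b'' - b' - (t'' - t') *\<^sub>R c) + (b' - b - (t' - t) *\<^sub>R c) = b'' - b - (t'' - t) *\<^sub>R c"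
      by (simp add: algebra_simps)
    have "frechet_dist q (b'' - b - (t'' - t) *\<^sub>R c) 0 \<le> e * (t'' - t') + e * (t' - t)"
      using that Y.frechet_dist_le_add[of "b'' - b' - (t'' - t') *\<^sub>R c" "b' - b - (t' - t) *\<^sub>R c"]
      unfolding eq R_def uvw prod.case by linarith
    with 1 that show ?thesis unfolding R_def uvw by (auto simp: algebra_simps)
  qed
  have p0: "p n 0 = 0" for n using X.separating by blast
  have refl: "R u u" for u
    using Y.zero[of 0 0] by (auto simp: R_def p0 split: prod.splits)
  have chain: "\<exists>u\<in>A. \<forall>n. R (f n) u" if fA: "range f \<subseteq> A" and fR: "\<And>n. R (f n) (f (Suc n))" for f
  proof -
    define a b t where "a n = fst (f n)" and "b n = fst (snd (f n))" and "t n = snd (snd (f n))" for n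
    have f: "f n = (a n, b n, t n)" for n by (simp add: a_def b_def t_def)
    have "R (f i) (f j)" if "i \<le> j" for i j
      using that by (rule transitive_stepwise_le) (auto intro: refl fR trans)
    then have ord: "t i \<le> t j" "p n (a j - a i) \<le> (t j - t i) * s n"
        "frechet_dist q (b j - b i - (t j - t i) *\<^sub>R c) 0 \<le> e * (t j - t i)"
      if "i \<le> j" for i j n using that unfolding f R_def by auto
    have A: "b i \<in> F (a i)" "t i \<le> 1" for i
      using fA f[of i] rangeI[of f i] unfolding A_def by auto
    obtain l where l: "t \<longlonglongrightarrow> l" "\<And>i. t i \<le> l"
      using incseq_convergent[of t 1] ord(1) A(2) unfolding incseq_def by blast
    \<comment> \<open>The Cauchy property is a limit over pairs of indices. The bounded monotone
      \<open>t\<close> has it, and \<open>a\<close> and \<open>b\<close> inherit it by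
      sandwiching.\<close>
    let ?S2 = "sequentially \<times>\<^sub>F sequentially :: (nat \<times> nat) filter"
    have "((\<lambda>ij. t (fst ij) - t (snd ij)) \<longlongrightarrow> l - l) ?S2"
      using filterlim_compose[OF l(1)] by (intro tendsto_diff) (auto intro: filterlim_fst filterlim_snd)
    then have d: "((\<lambda>ij. \<bar>t (fst ij) - t (snd ij)\<bar>) \<longlongrightarrow> 0) ?S2"
      by (auto intro: tendsto_rabs_zero)
    have pa: "p n (a i - a j) \<le> \<bar>t i - t j\<bar> * s n" for i j n
      using ord(1)[of i j] ord(2)[of i j n] ord(1)[of j i] ord(2)[of j i n] X.minus_commute_p[of n "a i" "a j"]
      by (cases "i \<le> j") (auto simp: abs_minus_commute)
    have "((\<lambda>ij. p n (a (fst ij) - a (snd ij))) \<longlongrightarrow> 0) ?S2" for n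
      by (rule tendsto_sandwich[OF _ _ tendsto_const])
        (use tendsto_mult[OF d tendsto_const[of "s n"]] in
          \<open>auto intro!: always_eventually X.seminorm_nonneg pa\<close>)
    then have "((\<lambda>ij. frechet_dist p (a (fst ij)) (a (snd ij))) \<longlongrightarrow> 0) ?S2"
      unfolding X.frechet_dist_diff[of "a x" for x] by (simp add: X.frechet_dist_tendsto_0_iff)
    then obtain a0 where a0: "limitin X.mtopology a a0 sequentially"
      by (rule X.limit_exists_if_Cauchy)
    \<comment> \<open>The increment of \<open>b\<close> is the allowed error plus the drift along
      \<open>c\<close>; absolute values make the bound symmetric in \<open>i\<close> and
      \<open>j\<close>.\<close>
    have dle: "frechet_dist q (b j) (b i) \<le> e * \<bar>t j - t i\<bar> + frechet_dist q (\<bar>t j - t i\<bar> *\<^sub>R c) 0"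
      if "i \<le> j" for i j
      using ord(1,3)[OF that]
        Y.frechet_dist_le_add[of "b j - b i - (t j - t i) *\<^sub>R c" "(t j - t i) *\<^sub>R c"]
        Y.frechet_dist_diff[of "b j" "b i"] by simp
    have db: "frechet_dist q (b i) (b j) \<le> e * \<bar>t i - t j\<bar> + frechet_dist q (\<bar>t i - t j\<bar> *\<^sub>R c) 0" for i j
      using dle[of i j] dle[of j i] Y.commute[of "b i" "b j"] abs_minus_commute[of "t i" "t j"]
      by (cases "i \<le> j") auto
    have "((\<lambda>ij. e * \<bar>t (fst ij) - t (snd ij)\<bar> + frechet_dist q (\<bar>t (fst ij) - t (snd ij)\<bar> *\<^sub>R c) 0)
        \<longlongrightarrow> e * 0 + 0) ?S2"
      by (intro tendsto_add tendsto_mult tendsto_const d Y.frechet_dist_scale_tendsto_0)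
    then have "((\<lambda>ij. e * \<bar>t (fst ij) - t (snd ij)\<bar> + frechet_dist q (\<bar>t (fst ij) - t (snd ij)\<bar> *\<^sub>R c) 0)
        \<longlongrightarrow> 0) ?S2"
      by simp
    then have "((\<lambda>ij. frechet_dist q (b (fst ij)) (b (snd ij))) \<longlongrightarrow> 0) ?S2"
      by (rule tendsto_sandwich[OF always_eventually always_eventually tendsto_const, rotated -1])
        (simp_all add: db)
    then obtain b0 where b0: "limitin Y.mtopology b b0 sequentially"
      by (rule Y.limit_exists_if_Cauchy)
    have "limitin (prod_topology X.mtopology Y.mtopology) (\<lambda>i. (a i, b i)) (a0, b0) sequentially"
      using a0 b0 by (simp add: limitin_pairwise comp_def)
    then have "(a0, b0) \<in> Gr F"
      by (rule limitin_closedin[OF _ closed]) (auto simp: Gr_def A)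
    moreover have "l \<le> 1" using l(1) A(2) by (intro LIMSEQ_le_const2) auto
    ultimately have uA: "(a0, b0, l) \<in> A" by (simp add: A_def Gr_def)
    have lim_a: "(\<lambda>i. p n (a i - a0)) \<longlonglongrightarrow> 0" for n
      using a0 by (simp add: X.limitin_metric_dist_null X.frechet_dist_tendsto_0_iff)
    have lim_b: "(\<lambda>i. frechet_dist q (b i) b0) \<longlonglongrightarrow> 0"
      using b0 by (simp add: Y.limitin_metric_dist_null)
    show ?thesis
    proof (intro bexI[OF _ uA] allI)
      fix i
      \<comment> \<open>Replacing \<open>t j\<close> by its upper bound \<open>l\<close> makes the
        bound independent of \<open>j\<close>, as passing to the limit requires; this uses
        \<open>0 \<le> s n\<close>.\<close>
      have s: "p n (a j - a k) \<le> (l - t k) * s n" if "k \<le> j" for n j k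
        using ord(2)[OF that, of n] mult_right_mono[of "t j - t k" "l - t k" "s n"] l(2)[of j] s0 by force
      have 1: "p n (a0 - a i) \<le> (l - t i) * s n" for n
        by (rule X.limit_seminorm_le[where b = "\<lambda>i. (l - t i) * s n", OF lim_a s])
      \<comment> \<open>Comparing \<open>b0\<close> with \<open>b i\<close> through
        \<open>b j\<close> costs the two outer terms, which vanish as \<open>j\<close>
        grows.\<close>
      let ?g = "\<lambda>j. frechet_dist q (b j) b0 + e * (l - t i) + frechet_dist q ((t j - l) *\<^sub>R c) 0"
      have "(\<lambda>j. t j - l) \<longlonglongrightarrow> 0" using l(1) by (simp add: LIM_zero)
      then have g: "?g \<longlonglongrightarrow> 0 + e * (l - t i) + 0"
        by (intro tendsto_intros lim_b Y.frechet_dist_scale_tendsto_0)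
      have "frechet_dist q (b0 - b i - (l - t i) *\<^sub>R c) 0 \<le> ?g j" if "i \<le> j" for j
      proof -
        have eq: "b0 - b i - (l - t i) *\<^sub>R c
            = (b0 - b j) + ((b j - b i - (t j - t i) *\<^sub>R c) + (t j - l) *\<^sub>R c)"
          by (simp add: algebra_simps)
        have "frechet_dist q (b0 - b i - (l - t i) *\<^sub>R c) 0 \<le> frechet_dist q (b0 - b j) 0
            + (frechet_dist q (b j - b i - (t j - t i) *\<^sub>R c) 0 + frechet_dist q ((t j - l) *\<^sub>R c) 0)"
          unfolding eq by (intro order_trans[OF Y.frechet_dist_le_add] add_left_mono Y.frechet_dist_le_add)
        moreover have "frechet_dist q (b0 - b j) 0 = frechet_dist q (b j) b0"
          using Y.frechet_dist_diff Y.commute by metis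
        moreover have "e * (t j - t i) \<le> e * (l - t i)" using e l(2)[of j] by simp
        ultimately show ?thesis using ord(3)[OF that] by linarith
      qed
      then have "frechet_dist q (b0 - b i - (l - t i) *\<^sub>R c) 0 \<le> e * (l - t i)"
        using LIMSEQ_le_const[OF g] by auto
      with 1 l(2) show "R (f i) (a0, b0, l)" by (simp add: f R_def)
    qed
  qed
  obtain m where m: "m \<in> A" "R (x, y, 0) m" "\<And>z. z \<in> A \<Longrightarrow> R m z \<Longrightarrow> snd (snd z) \<le> snd (snd m)"
  proof (rule brezis_browder[where A = A and R = R and \<phi> = "\<lambda>z. snd (snd z)", OF _ trans refl _ _ chain])
    show "(x, y, 0) \<in> A" using xy by (simp add: A_def)
    show "snd (snd u) \<le> snd (snd v)" if "R u v" for u v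
      using that by (simp add: R_def split: prod.splits)
    show "snd (snd u) \<le> 1" if "u \<in> A" for u using that by (auto simp: A_def)
  qed (assumption | rule that)+
  obtain a b t where abt: "m = (a, b, t)" by (metis prod_cases3)
  have ab: "b \<in> F a" "0 \<le> t" "t \<le> 1" "\<And>n. p n (a - x) \<le> t * s n"
    "frechet_dist q (b - y - t *\<^sub>R c) 0 \<le> e * t"
    using m(1,2) unfolding abt A_def R_def by auto
  have dist: "frechet_dist q b (y + t *\<^sub>R c) \<le> e * t"
    using ab(5) Y.frechet_dist_diff[of b "y + t *\<^sub>R c"] by (simp add: algebra_simps)
  have "t = 1"
  proof (rule ccontr)
    assume "t \<noteq> 1"
    with ab(3) have "0 < 1 - t" by simp
    have "c \<in> Dprime q F a b (Pi_box p s)" using D ab dist by auto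
    from Dprime_step[OF this e \<open>0 < 1 - t\<close>]
    obtain h u b' where h: "0 < h" "h < 1 - t" "u \<in> Pi_box p s" "b' \<in> F (a + h *\<^sub>R u)"
      "frechet_dist q b' (b + h *\<^sub>R c) < e * h" by blast
    \<comment> \<open>The derivative step is a strict increase of the parameter by \<open>h\<close>,
      and \<open>h < 1 - t\<close> keeps the new triple in \<open>A\<close>; this contradicts the
      maximality of \<open>m\<close>.\<close>
    have "R m (a + h *\<^sub>R u, b', t + h)"
      using h Y.frechet_dist_diff[of b' "b + h *\<^sub>R c"] unfolding abt R_def
      by (auto simp: Pi_box_def X.seminorm_scale algebra_simps)
    moreover have "(a + h *\<^sub>R u, b', t + h) \<in> A" using h by (simp add: A_def)
    ultimately show False using m(3) h(1) unfolding abt by force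
  qed
  then show ?thesis using ab dist by (auto simp: Pi_box_def)
qed

section \<open>Passage to the closure\<close>

theorem theorem2:
  fixes p :: "nat \<Rightarrow> 'a::real_vector \<Rightarrow> real"
    and q :: "nat \<Rightarrow> 'b::real_vector \<Rightarrow> real"
    and F :: "'a \<Rightarrow> 'b set"
    and U :: "'a set" and V :: "'b set"
    and s :: "nat \<Rightarrow> real" and C :: "'b set"
  assumes "frechet_space p" and "frechet_space q"
    and "closedin (prod_topology (frechet_topology p) (frechet_topology q)) (Gr F)"
    and "openin (frechet_topology p) U" and "openin (frechet_topology q) V"
    and "Gr F \<inter> (U \<times> V) \<noteq> {}"
    and "\<forall>i. 0 \<le> s i" and "C \<noteq> {}"
    and "\<forall>(x, y) \<in> (U \<times> V) \<inter> Gr F. C \<subseteq> Dprime q F x y (Pi_box p s)"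
  shows "\<forall>(x, y) \<in> Gr F.
      (\<lambda>u. x + u) ` Pi_box p s \<subseteq> U \<longrightarrow> segments y C \<subseteq> V \<longrightarrow>
      (\<lambda>c. y + c) ` C \<subseteq>
        (frechet_topology q) closure_of (mv_image F ((\<lambda>u. x + u) ` Pi_box p s))"
proof (intro ballI, clarify)
  interpret Y: frechet_space q by fact
  fix x y c assume xy: "(x, y) \<in> Gr F" and U: "(\<lambda>u. x + u) ` Pi_box p s \<subseteq> U"
    and V: "segments y C \<subseteq> V" and c: "c \<in> C"
  have "\<And>t. t \<in> {0..1} \<Longrightarrow> y + t *\<^sub>R c \<in> V" using V c unfolding segments_def by blast
  with assms(5) obtain r where r: "r > 0"
    "\<And>t z. t \<in> {0..1} \<Longrightarrow> frechet_dist q z (y + t *\<^sub>R c) \<le> r \<Longrightarrow> z \<in> V"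
    using Y.segment_nbhd by metis
  have "\<exists>b \<in> mv_image F ((\<lambda>u. x + u) ` Pi_box p s). frechet_dist q b (y + c) < e" if "0 < e" for e
  proof -
    \<comment> \<open>The bound \<open>d \<le> r\<close> keeps the reachable values in
      \<open>V\<close>, and \<open>d < e\<close> turns the non-strict endpoint estimate into a
      strict one.\<close>
    define d where "d = min r (e / 2)"
    have d: "0 < d" "d \<le> r" "d < e" using r(1) that by (auto simp: d_def)
    have "\<exists>a b. b \<in> F a \<and> a - x \<in> Pi_box p s \<and> frechet_dist q b (y + c) \<le> d"
    proof (rule approximate_endpoint[OF assms(1-3)])
      show "0 \<le> s n" for n using assms(7) by blast
      show "y \<in> F x" using xy by (simp add: Gr_def)
      fix a b t assume ab: "b \<in> F a" "t \<in> {0..1}" "\<And>n. p n (a - x) \<le> t * s n"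
        "frechet_dist q b (y + t *\<^sub>R c) \<le> d * t"
      \<comment> \<open>Parameters up to 1 never leave the box around \<open>x\<close>, so reachable
        arguments stay in \<open>U\<close>.\<close>
      have "t * s n \<le> s n" for n using ab(2) assms(7) by (simp add: mult_left_le_one_le)
      then have "a - x \<in> Pi_box p s" using ab(3) order_trans unfolding Pi_box_def by blast
      then have "x + (a - x) \<in> U" using U by blast
      moreover have "d * t \<le> r" using ab(2) d(1) by (intro order_trans[OF mult_left_le d(2)]) auto
      then have "b \<in> V" using r(2)[OF ab(2)] ab(4) by simp
      ultimately show "c \<in> Dprime q F a b (Pi_box p s)"
        using assms(9) ab(1) c by (auto simp: Gr_def)
    qed (fact d(1))
    then obtain a b where ab: "b \<in> F a" "a - x \<in> Pi_box p s" "frechet_dist q b (y + c) \<le> d" by blast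
    then have "b \<in> mv_image F ((\<lambda>u. x + u) ` Pi_box p s)"
      unfolding mv_image_def by (auto intro!: bexI[of _ "a - x"])
    with ab(3) d(3) show ?thesis by force
  qed
  then show "y + c \<in> frechet_topology q closure_of (mv_image F ((\<lambda>u. x + u) ` Pi_box p s))"
    unfolding Y.metric_closure_of by (force simp: Y.commute)
qed

end
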